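(* Let $(V,[-,-,-],b)$ be an indecomposable Lorentzian 3-Lie algebra. Then it is either one-dimensional, simple, or else there is a Witt basis $(u,v,x_a)$, with $u,v$ complementary null directions, such that the nonzero 3-brackets take the form $$[u,x_a,x_b]=f_{ab}{}^c x_c\qquad\text{and}\qquad [x_a,x_b,x_c]=-f_{abc}v,$$ where $[x_a,x_b]=f_{ab}{}^c x_c$ makes the span of the $(x_a)$ into a compact semisimple Lie algebra $\mathfrak{g}$ and $f_{abc}=b([x_a,x_b],x_c)$.
   Context: A (finite-dimensional real) 3-Lie algebra is a finite-dimensional real vector space with a totally skewsymmetric trilinear bracket satisfying the fundamental identity $[x,y,[z,s,t]]=[[x,y,z],s,t]+[z,[x,y,s],t]+[z,s,[x,y,t]]$; it is metric if it carries a nondegenerate symmetric bilinear form $b$ with $b([x,y,z],s)+b(z,[x,y,s])=0$, and Lorentzian if $b$ has exactly one negative eigenvalue (signature $(1,p)$). Indecomposable: not isomorphic to an orthogonal direct sum ($[V_1,V_2,\cdot]=0$, $b(V_1,V_2)=0$) of two metric 3-Lie algebras of positive dimension. Simple: not one-dimensional and with no ideals ($[I,V,V]\subset I$) other than $0$ and $V$. A Witt basis $(u,v,x_a)$ here means $b(u,u)=b(v,v)=0$, $b(u,v)=1$, and $(x_a)$ is a basis of the orthogonal complement of $\operatorname{span}(u,v)$, which is positive-definite; summation over repeated indices is understood. *)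

theory Defs
  imports "HOL-Analysis.Analysis"
begin

definition trilinear :: "('a::real_vector \<Rightarrow> 'a \<Rightarrow> 'a \<Rightarrow> 'a) \<Rightarrow> bool" where
  "trilinear br \<longleftrightarrow> (\<forall>y z. linear (\<lambda>x. br x y z)) \<and> (\<forall>x z. linear (\<lambda>y. br x y z))
      \<and> (\<forall>x y. linear (\<lambda>z. br x y z))"

definition totally_skew :: "('a::real_vector \<Rightarrow> 'a \<Rightarrow> 'a \<Rightarrow> 'a) \<Rightarrow> bool" where
  "totally_skew br \<longleftrightarrow> (\<forall>x y z. br x y z = - br y x z \<and> br x y z = - br x z y)"

definition fundamental_identity :: "('a::real_vector \<Rightarrow> 'a \<Rightarrow> 'a \<Rightarrow> 'a) \<Rightarrow> bool" where
  "fundamental_identity br \<longleftrightarrow> (\<forall>x y z s t.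
      br x y (br z s t) = br (br x y z) s t + br z (br x y s) t + br z s (br x y t))"

definition three_lie :: "('a::real_vector \<Rightarrow> 'a \<Rightarrow> 'a \<Rightarrow> 'a) \<Rightarrow> bool" where
  "three_lie br \<longleftrightarrow> trilinear br \<and> totally_skew br \<and> fundamental_identity br"

definition sym_bilinear :: "('a::real_vector \<Rightarrow> 'a \<Rightarrow> real) \<Rightarrow> bool" where
  "sym_bilinear b \<longleftrightarrow> (\<forall>y. linear (\<lambda>x. b x y)) \<and> (\<forall>x y. b x y = b y x)"

definition nondegenerate :: "('a::real_vector \<Rightarrow> 'a \<Rightarrow> real) \<Rightarrow> bool" where
  "nondegenerate b \<longleftrightarrow> (\<forall>x. (\<forall>y. b x y = 0) \<longrightarrow> x = 0)"

definition metric_3lie :: "('a::real_vector \<Rightarrow> 'a \<Rightarrow> 'a \<Rightarrow> 'a) \<Rightarrow> ('a \<Rightarrow> 'a \<Rightarrow> real) \<Rightarrow> bool" where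
  "metric_3lie br b \<longleftrightarrow> three_lie br \<and> sym_bilinear b \<and> nondegenerate b
      \<and> (\<forall>x y z s. b (br x y z) s + b z (br x y s) = 0)"

definition lorentzian :: "('a::euclidean_space \<Rightarrow> 'a \<Rightarrow> real) \<Rightarrow> bool" where
  "lorentzian b \<longleftrightarrow> (\<exists>e :: nat \<Rightarrow> 'a.
      span (e ` {..<DIM('a)}) = UNIV
      \<and> (\<forall>i<DIM('a). \<forall>j<DIM('a). i \<noteq> j \<longrightarrow> b (e i) (e j) = 0)
      \<and> b (e 0) (e 0) = -1
      \<and> (\<forall>i. 0 < i \<and> i < DIM('a) \<longrightarrow> b (e i) (e i) = 1))"

text \<open>Indecomposable: no splitting as an orthogonal direct sum of two nonzero
  sub-3-Lie algebras V1, V2 with [V1,V2,-] = 0 (internal form of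
  "isomorphic to an orthogonal direct sum").\<close>
definition indecomposable :: "('a::real_vector \<Rightarrow> 'a \<Rightarrow> 'a \<Rightarrow> 'a) \<Rightarrow> ('a \<Rightarrow> 'a \<Rightarrow> real) \<Rightarrow> bool" where
  "indecomposable br b \<longleftrightarrow> \<not> (\<exists>V1 V2.
      subspace V1 \<and> subspace V2 \<and> V1 \<noteq> {0} \<and> V2 \<noteq> {0}
      \<and> V1 \<inter> V2 = {0} \<and> {x + y | x y. x \<in> V1 \<and> y \<in> V2} = UNIV
      \<and> (\<forall>x\<in>V1. \<forall>y\<in>V2. b x y = 0)
      \<and> (\<forall>x\<in>V1. \<forall>y\<in>V2. \<forall>z. br x y z = 0)
      \<and> (\<forall>x\<in>V1. \<forall>y\<in>V1. \<forall>z\<in>V1. br x y z \<in> V1)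
      \<and> (\<forall>x\<in>V2. \<forall>y\<in>V2. \<forall>z\<in>V2. br x y z \<in> V2))"

definition simple_3lie :: "('a::euclidean_space \<Rightarrow> 'a \<Rightarrow> 'a \<Rightarrow> 'a) \<Rightarrow> bool" where
  "simple_3lie br \<longleftrightarrow> DIM('a) \<noteq> 1 \<and>
      (\<forall>I. subspace I \<and> (\<forall>x\<in>I. \<forall>y z. br x y z \<in> I) \<longrightarrow> I = {0} \<or> I = UNIV)"

definition lie_algebra_on :: "'a::real_vector set \<Rightarrow> ('a \<Rightarrow> 'a \<Rightarrow> 'a) \<Rightarrow> bool" where
  "lie_algebra_on S L \<longleftrightarrow> subspace S
     \<and> (\<forall>x\<in>S. \<forall>y\<in>S. L x y \<in> S)
     \<and> (\<forall>x\<in>S. \<forall>y\<in>S. \<forall>z\<in>S. \<forall>c::real. L (c *\<^sub>R x + y) z = c *\<^sub>R L x z + L y z)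
     \<and> (\<forall>x\<in>S. \<forall>y\<in>S. \<forall>z\<in>S. \<forall>c::real. L z (c *\<^sub>R x + y) = c *\<^sub>R L z x + L z y)
     \<and> (\<forall>x\<in>S. L x x = 0)
     \<and> (\<forall>x\<in>S. \<forall>y\<in>S. \<forall>z\<in>S. L x (L y z) + L y (L z x) + L z (L x y) = 0)"

definition lie_ideal :: "'a::real_vector set \<Rightarrow> ('a \<Rightarrow> 'a \<Rightarrow> 'a) \<Rightarrow> 'a set \<Rightarrow> bool" where
  "lie_ideal S L I \<longleftrightarrow> subspace I \<and> I \<subseteq> S \<and> (\<forall>x\<in>I. \<forall>y\<in>S. L y x \<in> I)"

primrec derived_series :: "('a::real_vector \<Rightarrow> 'a \<Rightarrow> 'a) \<Rightarrow> 'a set \<Rightarrow> nat \<Rightarrow> 'a set" where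
  "derived_series L I 0 = I"
| "derived_series L I (Suc k) =
     span {L x y | x y. x \<in> derived_series L I k \<and> y \<in> derived_series L I k}"

definition solvable_lie :: "('a::real_vector \<Rightarrow> 'a \<Rightarrow> 'a) \<Rightarrow> 'a set \<Rightarrow> bool" where
  "solvable_lie L I \<longleftrightarrow> (\<exists>k. derived_series L I k = {0})"

definition semisimple_on :: "'a::real_vector set \<Rightarrow> ('a \<Rightarrow> 'a \<Rightarrow> 'a) \<Rightarrow> bool" where
  "semisimple_on S L \<longleftrightarrow> lie_algebra_on S L
     \<and> (\<forall>I. lie_ideal S L I \<and> solvable_lie L I \<longrightarrow> I = {0})"

text \<open>Compact (real) Lie algebra, algebraically: admits an ad-invariant inner product.\<close>
definition compact_lie_on :: "'a::real_vector set \<Rightarrow> ('a \<Rightarrow> 'a \<Rightarrow> 'a) \<Rightarrow> bool" where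
  "compact_lie_on S L \<longleftrightarrow> lie_algebra_on S L \<and> (\<exists>B :: 'a \<Rightarrow> 'a \<Rightarrow> real.
      (\<forall>x\<in>S. \<forall>y\<in>S. \<forall>z\<in>S. \<forall>c::real. B (c *\<^sub>R x + y) z = c * B x z + B y z)
    \<and> (\<forall>x\<in>S. \<forall>y\<in>S. B x y = B y x)
    \<and> (\<forall>x\<in>S. x \<noteq> 0 \<longrightarrow> B x x > 0)
    \<and> (\<forall>x\<in>S. \<forall>y\<in>S. \<forall>z\<in>S. B (L x y) z = - B y (L x z)))"

definition compact_semisimple_on :: "'a::real_vector set \<Rightarrow> ('a \<Rightarrow> 'a \<Rightarrow> 'a) \<Rightarrow> bool" where
  "compact_semisimple_on S L \<longleftrightarrow> compact_lie_on S L \<and> semisimple_on S L"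

definition witt_basis :: "('a::real_vector \<Rightarrow> 'a \<Rightarrow> real) \<Rightarrow> 'a \<Rightarrow> 'a \<Rightarrow> (nat \<Rightarrow> 'a) \<Rightarrow> nat \<Rightarrow> bool" where
  "witt_basis b u v x n \<longleftrightarrow> b u u = 0 \<and> b v v = 0 \<and> b u v = 1
     \<and> inj_on x {..<n} \<and> independent (x ` {..<n})
     \<and> span (x ` {..<n}) = {y. \<forall>w\<in>span {u, v}. b w y = 0}
     \<and> (\<forall>y\<in>span (x ` {..<n}). y \<noteq> 0 \<longrightarrow> b y y > 0)"

end

theory Submission
  imports Defs
begin

text \<open>A proper nonzero ideal I is degenerate by indecomposability, so the Lorentzian signature makes
  the intersection of I with its complement a null line spanned by some v. Writing [v,x,y] = l(x,y) v,
  the fundamental identity shows that each l(x,-) annihilates all brackets; it is therefore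
  represented by a central vector, which turns out to be null and orthogonal to a null plane
  containing v, hence is 0. So v is central. A least-squares choice of the complementary null
  vector u (see below) then forces [u,V,V] into the centre Z of the Euclidean 3-Lie algebra carried
  by the orthogonal complement W of span(u,v). The complement of Z in W is now a nondegenerate ideal, hence 0, so that
  [W,W,W] is contained in the line of v. Finally, [u,-,-] has no central elements on W, since such
  an element would be central in V, and a centreless compact Lie algebra is semisimple.\<close>

section \<open>Linear algebra of symmetric bilinear forms\<close>

text \<open>A Fredholm alternative. In Euclidean terms \<open>K\<close> on \<open>S\<close> is a
  self-adjoint operator \<open>T\<close>, whose image is the orthogonal complement of its kernel;
  \<open>rad\<close> says that \<open>l\<close> vanishes on that kernel. Degenerate forms are
  allowed, as the least-squares argument below requires.\<close>

lemma sym_bilinear_representation: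
  fixes K :: "'a::euclidean_space \<Rightarrow> 'a \<Rightarrow> real"
  assumes K: "sym_bilinear K" and l: "linear l" and S: "subspace S"
    and rad: "\<And>q. q \<in> S \<Longrightarrow> \<forall>r\<in>S. K q r = 0 \<Longrightarrow> l q = 0"
  shows "\<exists>p\<in>S. \<forall>q\<in>S. K p q = l q"
proof -
  have lin1: "linear (\<lambda>x. K x y)" for y using K by (simp add: sym_bilinear_def)
  have sym: "K x y = K y x" for x y using K unfolding sym_bilinear_def by blast
  have lin2: "linear (\<lambda>x. K y x)" for y using lin1[of y] by (simp add: sym[of y])
  obtain B where B: "B \<subseteq> S" "pairwise orthogonal B" "\<And>x. x \<in> B \<Longrightarrow> norm x = 1"
    "independent B" "card B = dim S" "span B = S"
    using orthonormal_basis_subspace[OF S] by metis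
  have fB: "finite B" using B(4) independent_imp_finite by blast
  have expand: "q = (\<Sum>i\<in>B. (q \<bullet> i) *\<^sub>R i)" if "q \<in> S" for q
  proof -
    have "q \<in> range (\<lambda>c. \<Sum>i\<in>B. c i *\<^sub>R i)"
      using that B(6) span_finite[OF fB] by metis
    then obtain c where c: "q = (\<Sum>i\<in>B. c i *\<^sub>R i)" by (rule rangeE)
    have "q \<bullet> j = c j" if j: "j \<in> B" for j
    proof -
      have "q \<bullet> j = (\<Sum>i\<in>B. c i * (i \<bullet> j))" unfolding c by (simp add: inner_sum_left)
      also have "\<dots> = (\<Sum>i\<in>B. if i = j then c j else 0)"
        using B(2,3) j by (intro sum.cong) (auto simp: pairwise_def orthogonal_def norm_eq_1)
      finally show ?thesis using fB j by simp
    qed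
    then show ?thesis using c by simp
  qed
  define T where "T p = (\<Sum>i\<in>B. K p i *\<^sub>R i)" for p
  have T_lin: "linear T" unfolding T_def
    by (rule linearI) (simp_all add: linear_add[OF lin1] linear_scale[OF lin1] scaleR_left_distrib
        sum.distrib scaleR_sum_right)
  have T_in: "T p \<in> S" for p unfolding T_def
    using B(1) S by (intro subspace_sum subspace_scale) auto
  have T_inner: "T p \<bullet> q = K p q" if "q \<in> S" for p q
  proof -
    have "K p q = K p (\<Sum>i\<in>B. (q \<bullet> i) *\<^sub>R i)" using expand[OF that] by simp
    also have "\<dots> = (\<Sum>i\<in>B. (q \<bullet> i) * K p i)"
      by (simp add: linear_sum[OF lin2] linear_scale[OF lin2])
    finally show ?thesis by (simp add: T_def inner_sum_left inner_commute[of q] mult.commute)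
  qed
  define a where "a = (\<Sum>i\<in>B. l i *\<^sub>R i)"
  have a_in: "a \<in> S" unfolding a_def using B(1) S by (intro subspace_sum subspace_scale) auto
  have a_inner: "a \<bullet> q = l q" if "q \<in> S" for q
  proof -
    have "l q = l (\<Sum>i\<in>B. (q \<bullet> i) *\<^sub>R i)" using expand[OF that] by simp
    also have "\<dots> = (\<Sum>i\<in>B. (q \<bullet> i) * l i)" by (simp add: linear_sum[OF l] linear_scale[OF l])
    finally show ?thesis by (simp add: a_def inner_sum_left inner_commute[of q] mult.commute)
  qed
  have sub: "subspace (T ` S)" using T_lin S by (rule linear_subspace_image)
  obtain y z where yz: "y \<in> span (T ` S)" "\<And>w. w \<in> span (T ` S) \<Longrightarrow> orthogonal z w" "a = y + z"
    using orthogonal_subspace_decomp_exists[of "T ` S" a] by metis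
  have y: "y \<in> T ` S" using yz(1) sub by (metis span_eq_iff)
  then have "y \<in> S" using T_in by auto
  then have zS: "z \<in> S" using yz(3) a_in S by (metis add_diff_cancel_left' subspace_diff)
  \<comment> \<open>The part \<open>z\<close> of \<open>a\<close> outside the image of
    \<open>T\<close> is in the radical of \<open>K\<close> on \<open>S\<close> by self-adjointness,
    so \<open>rad\<close> makes \<open>z\<close> orthogonal to \<open>a\<close>, and
    \<open>z\<close> vanishes.\<close>
  have "K z r = 0" if "r \<in> S" for r
  proof -
    have "z \<bullet> T r = 0" using yz(2)[of "T r"] that by (simp add: orthogonal_def span_base)
    then show ?thesis using T_inner[OF zS, of r] sym by (simp add: inner_commute)
  qed
  then have "a \<bullet> z = 0" using rad zS a_inner by simp
  moreover have "y \<bullet> z = 0" using yz(1,2) by (simp add: orthogonal_def inner_commute)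
  ultimately have "z = 0" using yz(3) by (simp add: inner_add_left)
  then obtain p where "p \<in> S" "a = T p" using y yz(3) by auto
  then show ?thesis using T_inner a_inner by metis
qed

text \<open>Orthonormal families in \<open>S\<close> are independent, so one of maximal cardinality
  exists; if it did not span \<open>S\<close>, a Gram-Schmidt step would enlarge it. Outside
  \<open>S\<close> the form may be indefinite.\<close>

lemma b_orthonormal_basis_exists:
  fixes b :: "'a::euclidean_space \<Rightarrow> 'a \<Rightarrow> real"
  assumes b: "sym_bilinear b" and S: "subspace S"
    and pos: "\<And>x. x \<in> S \<Longrightarrow> x \<noteq> 0 \<Longrightarrow> b x x > 0"
  obtains B where "finite B" "span B = S" "independent B"
    "\<And>x y. x \<in> B \<Longrightarrow> y \<in> B \<Longrightarrow> b x y = (if x = y then 1 else 0)"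
proof -
  have lin1: "linear (\<lambda>x. b x y)" for y using b by (simp add: sym_bilinear_def)
  have sym: "b x y = b y x" for x y using b unfolding sym_bilinear_def by blast
  have lin2: "linear (\<lambda>x. b y x)" for y using lin1[of y] by (simp add: sym[of y])
  define on where "on B \<longleftrightarrow> B \<subseteq> S \<and> (\<forall>x\<in>B. \<forall>y\<in>B. b x y = (if x = y then 1 else 0))" for B
  have coeff: "b (\<Sum>i\<in>A. c i *\<^sub>R i) j = c j" if "on B" "A \<subseteq> B" "finite A" "j \<in> A" for A B c j
  proof -
    have "b (\<Sum>i\<in>A. c i *\<^sub>R i) j = (\<Sum>i\<in>A. c i * b i j)"
      by (simp add: linear_sum[OF lin1] linear_scale[OF lin1])
    also have "\<dots> = (\<Sum>i\<in>A. if i = j then c j else 0)"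
      using that(1,2,4) by (intro sum.cong refl) (simp add: on_def subset_iff)
    finally show ?thesis using that by simp
  qed
  have indep: "independent B" if "on B" for B
  proof -
    have "c j = 0" if "finite A" "A \<subseteq> B" "(\<Sum>i\<in>A. c i *\<^sub>R i) = 0" "j \<in> A" for A c j
      using coeff[OF \<open>on B\<close>, of A j c] that linear_0[OF lin1] by simp
    then show ?thesis unfolding dependent_explicit by blast
  qed
  have "card B \<le> DIM('a)" if "on B" for B using indep[OF that] independent_bound by blast
  moreover have "on {}" by (simp add: on_def)
  ultimately obtain B where B: "on B" and Bmax: "\<And>C. on C \<Longrightarrow> card C \<le> card B"
    using ex_has_greatest_nat[of on "{}" card "DIM('a) + 1"] by (metis less_Suc_eq_le Suc_eq_plus1)
  have fB: "finite B" using indep[OF B] independent_bound by blast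
  have "x \<in> span B" if x: "x \<in> S" for x
  proof (rule ccontr)
    assume nx: "x \<notin> span B"
    define y where "y = x - (\<Sum>i\<in>B. b x i *\<^sub>R i)"
    have "(\<Sum>i\<in>B. b x i *\<^sub>R i) \<in> span B" by (intro span_sum span_scale span_base)
    then have "y \<noteq> 0" using nx unfolding y_def by auto
    moreover have yS: "y \<in> S" unfolding y_def using x S B
      by (intro subspace_diff subspace_sum subspace_scale) (auto simp: on_def)
    ultimately have yy: "b y y > 0" using pos by blast
    have yB: "b y j = 0" if "j \<in> B" for j
      using coeff[OF B subset_refl fB that, of "b x"] by (simp add: y_def linear_diff[OF lin1])
    define k where "k = (1 / sqrt (b y y)) *\<^sub>R y"
    have kk: "b k k = 1" using yy
      by (simp add: k_def linear_scale[OF lin1] linear_scale[OF lin2] field_simps)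
    have kB: "b k j = 0" "b j k = 0" if "j \<in> B" for j
      using yB[OF that] by (simp_all add: k_def linear_scale[OF lin1] sym[of j])
    have "k \<notin> B" using kB kk by force
    moreover have "on (insert k B)" using B kk kB yS S
      by (auto simp: on_def k_def subspace_scale)
    ultimately show False using Bmax[of "insert k B"] fB by simp
  qed
  moreover have "span B \<subseteq> S" using B S unfolding on_def by (metis span_minimal)
  ultimately have "span B = S" by blast
  then show thesis using that[OF fB] indep[OF B] B unfolding on_def by blast
qed

section \<open>Ideals and orthogonal complements in metric 3-Lie algebras\<close>

locale metric_three_lie =
  fixes br :: "'a::euclidean_space \<Rightarrow> 'a \<Rightarrow> 'a \<Rightarrow> 'a"
    and b :: "'a \<Rightarrow> 'a \<Rightarrow> real"
  assumes metric: "metric_3lie br b"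
begin

lemma br_linear: "linear (\<lambda>x. br x y z)" "linear (\<lambda>y. br x y z)" "linear (\<lambda>z. br x y z)"
  using metric by (auto simp: metric_3lie_def three_lie_def trilinear_def)

lemma form_sym_bilinear: "sym_bilinear b"
  using metric by (simp add: metric_3lie_def)

lemma form_sym: "b x y = b y x"
  using form_sym_bilinear unfolding sym_bilinear_def by blast

lemma form_linear: "linear (\<lambda>x. b x y)" "linear (\<lambda>y. b x y)"
proof -
  show *: "linear (\<lambda>x. b x y)" for y using form_sym_bilinear by (simp add: sym_bilinear_def)
  show "linear (\<lambda>y. b x y)" using *[of x] by (simp add: form_sym[of x])
qed

lemmas br_simps =
  linear_add[OF br_linear(1)] linear_add[OF br_linear(2)] linear_add[OF br_linear(3)]
  linear_diff[OF br_linear(1)] linear_diff[OF br_linear(2)] linear_diff[OF br_linear(3)]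
  linear_neg[OF br_linear(1)] linear_neg[OF br_linear(2)] linear_neg[OF br_linear(3)]
  linear_scale[OF br_linear(1)] linear_scale[OF br_linear(2)] linear_scale[OF br_linear(3)]
  linear_0[OF br_linear(1)] linear_0[OF br_linear(2)] linear_0[OF br_linear(3)]

lemmas form_simps =
  linear_add[OF form_linear(1)] linear_add[OF form_linear(2)]
  linear_diff[OF form_linear(1)] linear_diff[OF form_linear(2)]
  linear_neg[OF form_linear(1)] linear_neg[OF form_linear(2)]
  linear_scale[OF form_linear(1)] linear_scale[OF form_linear(2)]
  linear_0[OF form_linear(1)] linear_0[OF form_linear(2)]

lemma br_swap12: "br x y z = - br y x z" and br_swap23: "br x y z = - br x z y"
  using metric unfolding metric_3lie_def three_lie_def totally_skew_def by blast+

lemma br_swap13: "br x y z = - br z y x"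
  by (metis br_swap12 br_swap23)

lemma br_rotate: "br x y z = br y z x"
  by (metis br_swap12 br_swap23 add.inverse_inverse)

lemma br_same: "br x x y = 0" "br x y x = 0" "br y x x = 0"
  using br_swap12[of x x y] br_swap13[of x y x] br_swap23[of y x x]
  by (simp_all add: eq_neg_iff_add_eq_0 flip: scaleR_2)

lemma br_fundamental:
  "br x y (br z s t) = br (br x y z) s t + br z (br x y s) t + br z s (br x y t)"
  using metric unfolding metric_3lie_def three_lie_def fundamental_identity_def by blast

lemma form_invariant: "b (br x y z) s = - b z (br x y s)"
  using metric unfolding metric_3lie_def by (metis add_eq_0_iff2)

lemma form_eq_0I: "(\<And>y. b x y = 0) \<Longrightarrow> x = 0"
  using metric unfolding metric_3lie_def nondegenerate_def by blast

text \<open>Invariance turns b([p,x,y],z) into b(p,[x,y,z]) up to sign, and the form is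
  nondegenerate. This makes functionals that vanish on brackets into central vectors.\<close>

lemma central_if_orthogonal_to_brackets:
  assumes "\<And>x y z. b p (br x y z) = 0"
  shows "br p x y = 0"
  by (rule form_eq_0I) (metis assms br_rotate form_invariant neg_0_equal_iff_equal)

definition is_ideal :: "'a set \<Rightarrow> bool" where
  "is_ideal I \<longleftrightarrow> subspace I \<and> (\<forall>x\<in>I. \<forall>y z. br x y z \<in> I)"

definition perp :: "'a set \<Rightarrow> 'a set" where
  "perp S = {x. \<forall>s\<in>S. b x s = 0}"

lemma subspace_perp: "subspace (perp S)"
  by (auto simp: perp_def subspace_def form_simps)

lemma ideal_perp: "is_ideal I \<Longrightarrow> is_ideal (perp I)"
  unfolding is_ideal_def
proof (intro conjI ballI allI subspace_perp)
  fix x y z assume I: "subspace I \<and> (\<forall>x\<in>I. \<forall>y z. br x y z \<in> I)" and x: "x \<in> perp I"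
  have "b (br x y z) s = 0" if "s \<in> I" for s
  proof -
    have "br y z s \<in> I" using I that by (metis br_rotate)
    then show ?thesis using x form_invariant[of y z x s] br_rotate[of x y z] by (simp add: perp_def)
  qed
  then show "br x y z \<in> perp I" by (simp add: perp_def)
qed

text \<open>The form restricted to \<open>S\<close> has trivial radical, so some vector of
  \<open>S\<close> represents the functional b(x,-) on \<open>S\<close>.\<close>

lemma perp_decomposition:
  assumes "subspace S" and "S \<inter> perp S = {0}"
  obtains y where "y \<in> S" "x - y \<in> perp S"
proof -
  have "\<exists>p\<in>S. \<forall>q\<in>S. b p q = b x q"
  proof (rule sym_bilinear_representation[OF form_sym_bilinear form_linear(2) assms(1)])
    fix q assume "q \<in> S" "\<forall>r\<in>S. b q r = 0"
    then have "q = 0" using assms(2) by (auto simp: perp_def)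
    then show "b x q = 0" by (simp add: form_simps)
  qed
  then show thesis using that by (auto simp: perp_def form_simps)
qed

text \<open>The complement of an ideal is again an ideal, and a mixed bracket lies in both, hence
  vanishes. A proper nonzero \<open>I\<close> would therefore split the algebra
  orthogonally.\<close>

lemma nondegenerate_ideal_trivial:
  assumes indec: "indecomposable br b" and I: "is_ideal I" and nd: "I \<inter> perp I = {0}"
  shows "I = {0} \<or> I = UNIV"
proof (rule ccontr)
  assume neg: "\<not> (I = {0} \<or> I = UNIV)"
  have sub: "subspace I" using I by (simp add: is_ideal_def)
  have Ip: "is_ideal (perp I)" using ideal_perp[OF I] .
  have dec: "{x + y |x y. x \<in> I \<and> y \<in> perp I} = UNIV"
  proof -
    have "\<exists>p q. x = p + q \<and> p \<in> I \<and> q \<in> perp I" for x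
    proof -
      obtain p where "p \<in> I" "x - p \<in> perp I" using perp_decomposition[OF sub nd] .
      then show ?thesis by (intro exI[of _ p] exI[of _ "x - p"]) simp
    qed
    then show ?thesis by auto
  qed
  have pne: "perp I \<noteq> {0}"
  proof
    assume "perp I = {0}"
    then have "I = UNIV" using dec by auto
    then show False using neg by simp
  qed
  have mix: "br x y z = 0" if "x \<in> I" "y \<in> perp I" for x y z
  proof -
    have "br x y z \<in> I" using I that by (simp add: is_ideal_def)
    moreover have "br y z x \<in> perp I" using Ip that by (simp add: is_ideal_def)
    ultimately show ?thesis using nd br_rotate[of x y z] by auto
  qed
  have "subspace I \<and> subspace (perp I) \<and> I \<noteq> {0} \<and> perp I \<noteq> {0}
      \<and> I \<inter> perp I = {0} \<and> {x + y | x y. x \<in> I \<and> y \<in> perp I} = UNIV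
      \<and> (\<forall>x\<in>I. \<forall>y\<in>perp I. b x y = 0)
      \<and> (\<forall>x\<in>I. \<forall>y\<in>perp I. \<forall>z. br x y z = 0)
      \<and> (\<forall>x\<in>I. \<forall>y\<in>I. \<forall>z\<in>I. br x y z \<in> I)
      \<and> (\<forall>x\<in>perp I. \<forall>y\<in>perp I. \<forall>z\<in>perp I. br x y z \<in> perp I)"
    using sub subspace_perp neg nd dec pne mix I Ip
    by (auto simp: is_ideal_def perp_def form_sym)
  then show False using indec unfolding indecomposable_def by blast
qed

text \<open>A central vector with nonzero square spans a nondegenerate ideal. The null vector
  \<open>y\<close> rules out that this line is the whole space.\<close>

lemma no_nonnull_central_vector:
  assumes "indecomposable br b" and "\<And>y z. br x y z = 0" and "b x x \<noteq> 0" and "b y y = 0" "y \<noteq> 0"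
  shows False
proof -
  have "is_ideal (span {x})"
    unfolding is_ideal_def
  proof (intro conjI ballI allI subspace_span)
    fix y z s assume "y \<in> span {x}"
    then have "br y z s = 0" using assms(2) by (auto simp: span_singleton br_simps)
    then show "br y z s \<in> span {x}" by (simp add: span_zero)
  qed
  moreover have "span {x} \<inter> perp (span {x}) = {0}"
    using assms(3) by (auto simp: perp_def span_singleton form_simps)
  ultimately have "span {x} = {0} \<or> span {x} = UNIV"
    using nondegenerate_ideal_trivial assms(1) by blast
  then show False
  proof
    assume "span {x} = {0}"
    then have "x = 0" using span_base[of x "{x}"] by auto
    then show False using assms(3) by (simp add: form_simps)
  next
    assume "span {x} = UNIV"
    then obtain c where "y = c *\<^sub>R x" by (auto simp: span_singleton)
    then show False using assms(3-5) by (simp add: form_simps)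
  qed
qed

end

section \<open>Compact Lie algebras without centre\<close>

lemma lie_anticommute:
  assumes "lie_algebra_on S L" "x \<in> S" "y \<in> S"
  shows "L x y = - L y x"
proof -
  have S: "subspace S"
    and l1: "\<And>x y z c. x \<in> S \<Longrightarrow> y \<in> S \<Longrightarrow> z \<in> S \<Longrightarrow> L (c *\<^sub>R x + y) z = c *\<^sub>R L x z + L y z"
    and l2: "\<And>x y z c. x \<in> S \<Longrightarrow> y \<in> S \<Longrightarrow> z \<in> S \<Longrightarrow> L z (c *\<^sub>R x + y) = c *\<^sub>R L z x + L z y"
    and alt: "\<And>x. x \<in> S \<Longrightarrow> L x x = 0"
    using assms(1) unfolding lie_algebra_on_def by blast+
  have "x + y \<in> S" using assms S by (simp add: subspace_add)
  then show ?thesis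
    using alt[of "x + y"] l1[of x y "x + y" 1] l2[of x y x 1] l2[of x y y 1] alt assms(2,3)
    by (simp add: eq_neg_iff_add_eq_0 add.commute)
qed

text \<open>Each term must be an ideal of all of \<open>S\<close>, not only of \<open>I\<close>, so
  that the last nonzero term for a solvable \<open>I\<close> is an abelian ideal of
  \<open>S\<close>.\<close>

lemma lie_ideal_derived_series:
  assumes "lie_algebra_on S L" and "lie_ideal S L I"
  shows "lie_ideal S L (derived_series L I k)"
proof (induction k)
  case 0
  then show ?case using assms(2) by simp
next
  case (Suc k)
  define J where "J = derived_series L I k"
  define G where "G = {L x y |x y. x \<in> J \<and> y \<in> J}"
  have S: "subspace S" and closed: "\<And>x y. x \<in> S \<Longrightarrow> y \<in> S \<Longrightarrow> L x y \<in> S"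
    and l2: "\<And>x y z c. x \<in> S \<Longrightarrow> y \<in> S \<Longrightarrow> z \<in> S \<Longrightarrow> L z (c *\<^sub>R x + y) = c *\<^sub>R L z x + L z y"
    and jac: "\<And>x y z. x \<in> S \<Longrightarrow> y \<in> S \<Longrightarrow> z \<in> S \<Longrightarrow> L x (L y z) + L y (L z x) + L z (L x y) = 0"
    using assms(1) unfolding lie_algebra_on_def by blast+
  have J: "subspace J" "J \<subseteq> S" "\<And>x y. x \<in> J \<Longrightarrow> y \<in> S \<Longrightarrow> L y x \<in> J"
    using Suc unfolding lie_ideal_def J_def by blast+
  note anti = lie_anticommute[OF assms(1)]
  have GS: "G \<subseteq> S" using closed J(2) by (auto simp: G_def)
  then have sub: "span G \<subseteq> S" using S by (rule span_minimal)
  have zero: "L y 0 = 0" if "y \<in> S" for y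
    using l2[of 0 0 y 1] that S by (simp add: subspace_0)
  have "L y x \<in> span G" if x: "x \<in> span G" and y: "y \<in> S" for x y
  proof -
    \<comment> \<open>Membership in \<open>S\<close> is carried through the induction because
      \<open>L\<close> is assumed linear only on \<open>S\<close>.\<close>
    have "x \<in> S \<and> L y x \<in> span G" using x
    proof (induction rule: span_induct_alt)
      case base
      show ?case using zero[OF y] S by (simp add: subspace_0 span_zero)
    next
      case (step c g h)
      then obtain p q where g: "g = L p q" "p \<in> J" "q \<in> J" by (auto simp: G_def)
      have pq: "p \<in> S" "q \<in> S" using g J(2) by auto
      have "L q y \<in> J" using anti[OF pq(2) y] J(1) J(3)[OF g(3) y] by (simp add: subspace_neg)
      then have "L p (L q y) \<in> span G" "L q (L y p) \<in> span G"
        using g(2,3) J(3)[OF g(2) y] by (auto simp: G_def intro!: span_base)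
      \<comment> \<open>The Jacobi identity rewrites [y,[p,q]] through brackets of two elements of
        \<open>J\<close>.\<close>
      moreover have "L y g = - (L p (L q y) + L q (L y p))"
        using jac[OF y pq] unfolding g(1) by (simp only: eq_neg_iff_add_eq_0 add.assoc)
      ultimately have "L y g \<in> span G" by (metis span_neg span_add)
      moreover have "g \<in> S" using g pq closed by simp
      ultimately show ?case using step l2[of g h y c] y S
        by (simp add: span_add span_scale subspace_add subspace_scale)
    qed
    then show ?thesis by blast
  qed
  then show ?case using sub by (simp add: lie_ideal_def G_def J_def)
qed

text \<open>For \<open>x\<close> in an abelian ideal, [x,y] is in the ideal as well, so [x,[x,y]] =
  0. Invariance gives B([x,y],[x,y]) = -B(y,[x,[x,y]]) = 0, so \<open>x\<close> is central. Hence no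
  derived series can reach zero from a nonzero term.\<close>

lemma compact_centerless_semisimple:
  assumes compact: "compact_lie_on S L"
    and centerless: "\<And>x. x \<in> S \<Longrightarrow> (\<And>y. y \<in> S \<Longrightarrow> L x y = 0) \<Longrightarrow> x = 0"
  shows "semisimple_on S L"
  unfolding semisimple_on_def
proof (intro conjI allI impI)
  show lie: "lie_algebra_on S L" using compact by (simp add: compact_lie_on_def)
  fix I assume I: "lie_ideal S L I \<and> solvable_lie L I"
  obtain B :: "'a \<Rightarrow> 'a \<Rightarrow> real" where
    B: "(\<forall>x\<in>S. \<forall>y\<in>S. \<forall>z\<in>S. \<forall>c::real. B (c *\<^sub>R x + y) z = c * B x z + B y z)
      \<and> (\<forall>x\<in>S. \<forall>y\<in>S. B x y = B y x)
      \<and> (\<forall>x\<in>S. x \<noteq> 0 \<longrightarrow> B x x > 0)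
      \<and> (\<forall>x\<in>S. \<forall>y\<in>S. \<forall>z\<in>S. B (L x y) z = - B y (L x z))"
    using compact unfolding compact_lie_on_def by (elim conjE exE) (rule that, intro conjI)
  have B_lin: "\<And>x y z c. x \<in> S \<Longrightarrow> y \<in> S \<Longrightarrow> z \<in> S \<Longrightarrow> B (c *\<^sub>R x + y) z = c * B x z + B y z"
    and B_sym: "\<And>x y. x \<in> S \<Longrightarrow> y \<in> S \<Longrightarrow> B x y = B y x"
    and B_pos: "\<And>x. x \<in> S \<Longrightarrow> x \<noteq> 0 \<Longrightarrow> B x x > 0"
    and B_inv: "\<And>x y z. x \<in> S \<Longrightarrow> y \<in> S \<Longrightarrow> z \<in> S \<Longrightarrow> B (L x y) z = - B y (L x z)"
    using B by blast+
  have S: "subspace S" and closed: "\<And>x y. x \<in> S \<Longrightarrow> y \<in> S \<Longrightarrow> L x y \<in> S"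
    using lie unfolding lie_algebra_on_def by blast+
  note anti = lie_anticommute[OF lie]
  have step: "derived_series L I k = {0}" if d: "derived_series L I (Suc k) = {0}" for k
  proof -
    define J where "J = derived_series L I k"
    have J: "subspace J" "J \<subseteq> S" "\<And>x y. x \<in> J \<Longrightarrow> y \<in> S \<Longrightarrow> L y x \<in> J"
      using lie_ideal_derived_series[OF lie, of I k] I unfolding lie_ideal_def J_def by blast+
    have ab: "L x y = 0" if "x \<in> J" "y \<in> J" for x y
    proof -
      have "L x y \<in> span {L x y | x y. x \<in> J \<and> y \<in> J}" using that by (blast intro: span_base)
      then show ?thesis using d by (simp add: J_def)
    qed
    have "x = 0" if x: "x \<in> J" for x
    proof (rule centerless)
      show xS: "x \<in> S" using x J(2) by blast
      fix y assume y: "y \<in> S"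
      have "L x y \<in> J" using anti[OF xS y] J(1) J(3)[OF x y] by (simp add: subspace_neg)
      then have "L x (L x y) = 0" using ab x by blast
      moreover have "B y 0 = 0"
        using B_lin[of 0 0 y 1] B_sym[of y 0] y S by (simp add: subspace_0)
      ultimately have "B (L x y) (L x y) = 0" using B_inv[OF xS y closed[OF xS y]] by simp
      then show "L x y = 0" using B_pos[OF closed[OF xS y]] by force
    qed
    then show ?thesis using J(1) subspace_0 unfolding J_def by blast
  qed
  obtain k where "derived_series L I k = {0}" using I by (auto simp: solvable_lie_def)
  then have "derived_series L I 0 = {0}"
  proof (induction k)
    case (Suc k)
    show ?case using Suc.IH[OF step[OF Suc.prems]] .
  qed
  then show "I = {0}" by simp
qed

section \<open>Null vectors and null ideals in Lorentzian signature\<close>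

text \<open>The Lorentzian signature enters only as positivity on the complement of
  \<open>e\<close>, which will be a timelike basis vector.\<close>

locale null_vector = metric_three_lie +
  fixes e v
  assumes spacelike: "\<And>x. b x e = 0 \<Longrightarrow> x \<noteq> 0 \<Longrightarrow> b x x > 0"
    and v_nonzero: "v \<noteq> 0" and v_null: "b v v = 0"
begin

text \<open>Since \<open>v\<close> is null and orthogonal to \<open>y\<close>, subtracting a
  multiple of \<open>v\<close> leaves b(y,y) unchanged. As b(v,e) is nonzero, a suitable multiple
  moves \<open>y\<close> into the complement of \<open>e\<close>, where the form is
  positive.\<close>

lemma v_perp:
  assumes "b y v = 0"
  shows v_perp_nonneg: "b y y \<ge> 0" and v_perp_null: "b y y = 0 \<Longrightarrow> \<exists>c. y = c *\<^sub>R v"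
proof -
  have ve: "b v e \<noteq> 0" using spacelike[of v] v_nonzero v_null by force
  define c where "c = b y e / b v e"
  define y' where "y' = y - c *\<^sub>R v"
  have "b y' e = 0" using ve by (simp add: y'_def c_def form_simps)
  then have *: "y' = 0 \<or> b y' y' > 0" using spacelike by blast
  have eq: "b y' y' = b y y" using assms v_null form_sym[of v y] by (simp add: y'_def form_simps)
  show "b y y \<ge> 0" using * eq by (auto simp: form_simps)
  show "\<exists>c. y = c *\<^sub>R v" if "b y y = 0" using * eq that by (auto simp: y'_def)
qed

text \<open>Adding c v to \<open>u\<close> changes b(u,u) by 2c and keeps b(u,v).\<close>

lemma null_shift:
  assumes "b u v = 1"
  obtains c where "b (u + c *\<^sub>R v) (u + c *\<^sub>R v) = 0" "b (u + c *\<^sub>R v) v = 1"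
  by (rule that[of "- b u u / 2"]) (use assms v_null form_sym[of v u] in \<open>simp_all add: form_simps\<close>)

lemma null_complement: obtains u where "b u u = 0" "b u v = 1"
proof -
  obtain y where y: "b v y \<noteq> 0" using form_eq_0I[of v] v_nonzero by blast
  have "b ((1 / b v y) *\<^sub>R y) v = 1" using y form_sym[of y v] by (simp add: form_simps)
  then show thesis using null_shift that by metis
qed

lemma spacelike_complement:
  assumes "b u v = 1" "b y u = 0" "b y v = 0" "y \<noteq> 0"
  shows "b y y > 0"
proof (rule ccontr)
  assume "\<not> b y y > 0"
  then obtain c where c: "y = c *\<^sub>R v" using v_perp[OF assms(3)] by force
  then have "c = 0" using assms(1,2) form_sym[of v u] by (simp add: form_simps)
  then show False using c assms(4) by simp
qed

lemma null_pair_decomposition: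
  assumes "b u u = 0" "b u v = 1"
  shows "\<exists>s\<in>perp {u, v}. y = s + b y v *\<^sub>R u + b y u *\<^sub>R v"
  by (rule bexI[of _ "y - b y v *\<^sub>R u - b y u *\<^sub>R v"])
    (use assms form_sym[of v u] v_null in \<open>simp_all add: perp_def form_simps\<close>)

lemma null_ideal_central:
  assumes ideal: "\<And>x y. \<exists>c. br v x y = c *\<^sub>R v"
  shows "br v x y = 0"
proof -
  obtain u where u: "b u u = 0" "b u v = 1" by (rule null_complement)
  define l where "l x y = b (br v x y) u" for x y
  have l: "br v x y = l x y *\<^sub>R v" for x y
    using ideal[of x y] u(2) form_sym[of v u] by (auto simp: l_def form_simps)
  have l_swap: "l x y = - l y x" for x y using br_swap23[of v x y] by (simp add: l_def form_simps)
  have l_lin: "linear (l x)" for x unfolding l_def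
    by (rule linearI) (simp_all add: br_simps form_simps)
  have l_v: "l x v = 0" for x by (simp add: l_def br_same form_simps)
  have l_u: "l x u = 0" for x
    using form_invariant[of v x u u] form_sym[of u "br v x u"] by (simp add: l_def)
  \<comment> \<open>The derivation [v,x,-] equals l(x,-) v. The right-hand side is the Pfaffian of
    \<open>l\<close> on x, z, s, t, so it is totally skew in the four arguments.\<close>
  have derived: "l x (br z s t) = l x z * l s t - l x s * l z t + l x t * l z s" for x z s t
  proof -
    have "l x (br z s t) *\<^sub>R v = br (br v x z) s t + br z (br v x s) t + br z s (br v x t)"
      using br_fundamental[of v x z s t] l by simp
    also have "\<dots> = l x z *\<^sub>R br v s t - l x s *\<^sub>R br v z t + l x t *\<^sub>R br v z s"
      using br_swap12[of z v t] br_rotate[of v z s]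
      by (simp add: l[of x] br_simps)
    also have "\<dots> = (l x z * l s t - l x s * l z t + l x t * l z s) *\<^sub>R v"
      by (simp add: l algebra_simps)
    finally show ?thesis using v_nonzero by simp
  qed
  \<comment> \<open>Apply the derivation [x,y,-] to [v,z,s]: the left-hand side and the term
    containing [x,y,v] are both l(x,y) l(z,s) v and cancel. What remains is the invariance of
    \<open>l\<close>.\<close>
  have inv: "l (br x y z) s + l z (br x y s) = 0" for x y z s
  proof -
    have "br x y (br v z s) = br (br x y v) z s + br v (br x y z) s + br v z (br x y s)"
      by (rule br_fundamental)
    moreover have "br x y v = l x y *\<^sub>R v" using l br_rotate by metis
    ultimately have "(l (br x y z) s + l z (br x y s)) *\<^sub>R v = 0"
      by (simp add: br_simps l algebra_simps)
    then show ?thesis using v_nonzero by simp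
  qed
  \<comment> \<open>By \<open>derived\<close> both terms of \<open>inv\<close> equal the Pfaffian of
    \<open>l\<close> on x, y, z, s, so twice that Pfaffian is zero.\<close>
  have kills: "l s (br x y z) = 0" for s x y z
  proof -
    have "l s (br x y z) = - (l x s * l y z - l y s * l x z + l z s * l x y)"
      unfolding derived l_swap[of s x] l_swap[of s y] l_swap[of s z] by simp
    moreover have "l z (br x y s) = l x s * l y z - l y s * l x z + l z s * l x y"
      unfolding derived l_swap[of z x] l_swap[of z y] by simp
    ultimately show ?thesis using inv[of x y z s] l_swap[of "br x y z" s] by linarith
  qed
  obtain p where p: "\<And>q. b p q = l x q"
    using sym_bilinear_representation[OF form_sym_bilinear l_lin subspace_UNIV, of x]
      form_eq_0I linear_0[OF l_lin] by (metis UNIV_I)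
  have "br p y z = 0" for y z by (rule central_if_orthogonal_to_brackets) (simp add: p kills)
  then have "l p x = 0" by (simp add: l_def br_rotate[of v p x] form_simps)
  \<comment> \<open>Centrality of \<open>p\<close> gives l(p,x) = 0, and b(p,p) = l(x,p).\<close>
  then have "b p p = 0" using p[of p] l_swap[of x p] by simp
  then have "p = 0" using spacelike_complement[OF u(2), of p] p l_u l_v by force
  then show ?thesis using l[of x y] p[of y] by (simp add: form_simps)
qed

end

section \<open>Brackets in the presence of a central null vector\<close>

locale central_null_vector = null_vector +
  assumes v_central: "br v x y = 0"
begin

lemma br_v: "br v x y = 0" "br x v y = 0" "br x y v = 0"
  using v_central[of x y] br_rotate[of v x y] br_swap12[of x v y] by simp_all

lemma br_perp_v: "b (br x y z) v = 0" "b v (br x y z) = 0"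
  using form_invariant[of x y z v] form_sym[of v "br x y z"] by (simp_all add: br_v form_simps)

lemma br_in_perp: "br u x y \<in> perp {u, v}"
  using form_invariant[of x y u u] form_sym[of u "br x y u"] br_rotate[of u x y] br_perp_v
  by (simp add: perp_def)

text \<open>Among the complements of v, take one for which the operator (z, t) \<mapsto> [u,z,t] is orthogonal
  to all operators (z, t) \<mapsto> [q,z,t] with b(q,v) = 0. By the fundamental identity, the skew derivation
  A = [x,y,-] maps the former to (z, t) \<mapsto> [Au,z,t]. Moving A to the other factor, the squared norm
  of the latter is minus the pairing of [u,-,-] with [AAu,-,-], which vanishes.\<close>
lemma adapted_null_vector:
  obtains u where "b u u = 0" "b u v = 1"
    "\<And>x y z t s. b z v = 0 \<Longrightarrow> b t v = 0 \<Longrightarrow> b s v = 0 \<Longrightarrow> b (br (br u x y) z t) s = 0"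
proof -
  obtain w where w: "b w w = 0" "b w v = 1" by (rule null_complement)
  define W where "W = perp {w, v}"
  have W_iff: "y \<in> W \<longleftrightarrow> b y w = 0 \<and> b y v = 0" for y by (simp add: W_def perp_def)
  have W: "subspace W" unfolding W_def by (rule subspace_perp)
  obtain B where B: "finite B" "span B = W" "independent B"
    "\<And>x y. x \<in> B \<Longrightarrow> y \<in> B \<Longrightarrow> b x y = (if x = y then 1 else 0)"
    using b_orthonormal_basis_exists[OF form_sym_bilinear W] spacelike_complement[OF w(2)] W_iff
    by metis
  have v_w: "b v w = 1" using w(2) form_sym by metis
  have expand: "y = (\<Sum>i\<in>B. b y i *\<^sub>R i) + b y w *\<^sub>R v" if y: "b y v = 0" for y
  proof -
    define y' where "y' = y - b y w *\<^sub>R v"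
    have "y' \<in> W" using y v_w v_null by (simp add: W_iff y'_def form_simps)
    then have "y' \<in> range (\<lambda>c. \<Sum>i\<in>B. c i *\<^sub>R i)" using B(2) span_finite[OF B(1)] by metis
    then obtain c where c: "y' = (\<Sum>i\<in>B. c i *\<^sub>R i)" by (rule rangeE)
    have "c j = b y j" if j: "j \<in> B" for j
    proof -
      have "b v j = 0" using j B(2) W_iff[of j] form_sym[of v j] span_base by metis
      then have "b y j = b y' j" by (simp add: y'_def form_simps)
      also have "\<dots> = (\<Sum>i\<in>B. c i * b i j)"
        unfolding c by (simp add: linear_sum[OF form_linear(1)] form_simps)
      also have "\<dots> = (\<Sum>i\<in>B. if i = j then c j else 0)"
        using B(4) j by (intro sum.cong) auto
      finally show ?thesis using B(1) j by simp
    qed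
    then have "y' = (\<Sum>i\<in>B. b y i *\<^sub>R i)" unfolding c by (intro sum.cong) auto
    then show ?thesis by (simp add: y'_def algebra_simps)
  qed
  \<comment> \<open>A functional killing \<open>v\<close> sees a vector orthogonal to
    \<open>v\<close> only through its coordinates in \<open>B\<close>.\<close>
  have eval: "g y = (\<Sum>i\<in>B. b y i * g i)" if "linear g" "g v = 0" "b y v = 0" for g y
  proof -
    have "g y = g ((\<Sum>i\<in>B. b y i *\<^sub>R i) + b y w *\<^sub>R v)" using expand[OF that(3)] by simp
    then show ?thesis using that(2)
      by (simp add: linear_add[OF that(1)] linear_sum[OF that(1)] linear_scale[OF that(1)])
  qed
  \<comment> \<open>Here \<open>g\<close> descends to the quotient of the complement of
    \<open>v\<close> by the line of \<open>v\<close>. The skew operator [x,y,-] acts there and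
    passes between the two arguments of \<open>g\<close> under the trace, with a sign.\<close>
  have trace: "(\<Sum>z\<in>B. g z (br x y z)) = - (\<Sum>z\<in>B. g (br x y z) z)"
    if g: "\<And>z. linear (g z)" "\<And>z. linear (\<lambda>y. g y z)" "\<And>z. g v z = 0" "\<And>z. g z v = 0"
    for g :: "'a \<Rightarrow> 'a \<Rightarrow> real" and x y
  proof -
    have "(\<Sum>z\<in>B. g (br x y z) z) = (\<Sum>z\<in>B. \<Sum>i\<in>B. b (br x y z) i * g i z)"
      by (intro sum.cong refl eval g br_perp_v)
    also have "\<dots> = (\<Sum>i\<in>B. \<Sum>z\<in>B. b (br x y z) i * g i z)" by (rule sum.swap)
    also have "\<dots> = (\<Sum>i\<in>B. - (\<Sum>z\<in>B. b (br x y i) z * g i z))"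
      unfolding sum_negf[symmetric]
      by (intro sum.cong refl) (use form_invariant form_sym in \<open>metis mult_minus_left\<close>)
    also have "\<dots> = (\<Sum>i\<in>B. - g i (br x y i))"
      using eval[OF g(1) g(4) br_perp_v(1)] by simp
    finally show ?thesis by (simp add: sum_negf)
  qed
  \<comment> \<open>The Hilbert-Schmidt pairing of the operators [p,-,-] and [q,-,-] over
    \<open>B\<close>. It is positive semidefinite because brackets are orthogonal to
    \<open>v\<close>, but degenerate, since \<open>v\<close> is in its radical.\<close>
  define K where "K p q = (\<Sum>z\<in>B. \<Sum>t\<in>B. b (br p z t) (br q z t))" for p q
  have K_lin: "linear (\<lambda>p. K p q)" for q unfolding K_def
    by (rule linearI) (simp_all add: br_simps form_simps sum.distrib sum_distrib_left)
  have K_sym: "K p q = K q p" for p q unfolding K_def by (intro sum.cong refl form_sym)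
  have K_bil: "sym_bilinear K" unfolding sym_bilinear_def using K_lin K_sym by blast
  have K_lin2: "linear (K p)" for p
  proof -
    have "K p = (\<lambda>x. K x p)" by (rule ext) (rule K_sym)
    then show ?thesis using K_lin[of p] by simp
  qed
  have K_v: "K p v = 0" for p by (simp add: K_def br_v form_simps)
  have K_null: "b (br q z t) s = 0" if "K q q = 0" "z \<in> B" "t \<in> B" "b s v = 0" for q z t s
  proof -
    have nonneg: "b (br q z t) (br q z t) \<ge> 0" for z t by (rule v_perp_nonneg) (rule br_perp_v)
    have "b (br q z t) (br q z t) = 0"
      using that(1-3) B(1) nonneg unfolding K_def
      by (simp add: sum_nonneg_eq_0_iff sum_nonneg)
    then obtain c where "br q z t = c *\<^sub>R v" using v_perp_null br_perp_v by blast
    then show ?thesis using that(4) form_sym[of v s] by (simp add: form_simps)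
  qed
  \<comment> \<open>These are the normal equations for projecting \<open>w\<close> to
    \<open>W\<close> under \<open>K\<close>. They are solvable: K(q,q) = 0 forces the brackets
    [q,z,t] on \<open>B\<close> to be multiples of \<open>v\<close>, and these are orthogonal to all
    brackets.\<close>
  have "\<exists>p\<in>W. \<forall>q\<in>W. K p q = K w q"
  proof (rule sym_bilinear_representation[OF K_bil K_lin2 W])
    fix q assume "q \<in> W" "\<forall>r\<in>W. K q r = 0"
    then have "K q q = 0" by blast
    then have "b (br q z t) (br w z t) = 0" if "z \<in> B" "t \<in> B" for z t
      using K_null that br_perp_v by blast
    then show "K w q = 0" unfolding K_sym[of w q] by (simp add: K_def)
  qed
  then obtain p where p: "p \<in> W" "\<And>q. q \<in> W \<Longrightarrow> K p q = K w q" by blast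
  have "b (w - p) v = 1" using p(1) w(2) by (simp add: W_iff form_simps)
  then obtain c where c: "b (w - p + c *\<^sub>R v) (w - p + c *\<^sub>R v) = 0" "b (w - p + c *\<^sub>R v) v = 1"
    by (rule null_shift)
  \<comment> \<open>The least-squares residual w - p, made null by a multiple of \<open>v\<close>
    that \<open>K\<close> does not see.\<close>
  define u where "u = w - p + c *\<^sub>R v"
  have orth: "K q u = 0" if "b q v = 0" for q
  proof -
    define q' where "q' = q - b q w *\<^sub>R v"
    have "q' \<in> W" using that v_w v_null by (simp add: W_iff q'_def form_simps)
    then have "K u q' = 0" using p(2)[of q'] K_v[of q'] K_sym[of q' v]
      by (simp add: u_def linear_add[OF K_lin] linear_diff[OF K_lin] linear_scale[OF K_lin])
    then show ?thesis using K_v[of u] K_sym[of q u]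
      by (simp add: q'_def linear_diff[OF K_lin2] linear_scale[OF K_lin2])
  qed
  have null: "K (br x y u) (br x y u) = 0" for x y
  proof -
    define A where "A = br x y"
    define q where "q = A u"
    have fi: "A (br r z t) = br (A r) z t + br r (A z) t + br r z (A t)" for r z t
      unfolding A_def by (rule br_fundamental)
    have "K q q = (\<Sum>z\<in>B. \<Sum>t\<in>B. b (br q z t) (A (br u z t)))
      - (\<Sum>z\<in>B. \<Sum>t\<in>B. b (br q z t) (br u (A z) t))
      - (\<Sum>z\<in>B. \<Sum>t\<in>B. b (br q z t) (br u z (A t)))"
      unfolding K_def sum_subtractf[symmetric]
      by (intro sum.cong refl) (simp add: fi q_def form_simps)
    also have "(\<Sum>z\<in>B. \<Sum>t\<in>B. b (br q z t) (A (br u z t)))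
      = - (\<Sum>z\<in>B. \<Sum>t\<in>B. b (A (br q z t)) (br u z t))"
      unfolding A_def form_invariant[of x y] by (simp add: sum_negf)
    also have "(\<Sum>z\<in>B. \<Sum>t\<in>B. b (br q z t) (br u (A z) t))
      = - (\<Sum>z\<in>B. \<Sum>t\<in>B. b (br q (A z) t) (br u z t))"
    proof -
      have "(\<Sum>z\<in>B. b (br q z t) (br u (A z) t)) = - (\<Sum>z\<in>B. b (br q (A z) t) (br u z t))" for t
        unfolding A_def
        by (rule trace) (auto intro!: linearI simp: br_simps form_simps br_v)
      then have "(\<Sum>t\<in>B. \<Sum>z\<in>B. b (br q z t) (br u (A z) t))
        = - (\<Sum>t\<in>B. \<Sum>z\<in>B. b (br q (A z) t) (br u z t))" by (simp add: sum_negf)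
      then show ?thesis by (simp only: sum.swap[of "\<lambda>z t. b (br q z t) (br u (A z) t)"]
        sum.swap[of "\<lambda>z t. b (br q (A z) t) (br u z t)"])
    qed
    also have "(\<Sum>z\<in>B. \<Sum>t\<in>B. b (br q z t) (br u z (A t)))
      = - (\<Sum>z\<in>B. \<Sum>t\<in>B. b (br q z (A t)) (br u z t))"
    proof -
      have "(\<Sum>t\<in>B. b (br q z t) (br u z (A t))) = - (\<Sum>t\<in>B. b (br q z (A t)) (br u z t))" for z
        unfolding A_def
        by (rule trace) (auto intro!: linearI simp: br_simps form_simps br_v)
      then show ?thesis by (simp add: sum_negf)
    qed
    \<comment> \<open>Expanding A[q,z,t] by \<open>fi\<close> cancels the terms with A z and A t and
      leaves only [A q,z,t].\<close>
    also have "- (\<Sum>z\<in>B. \<Sum>t\<in>B. b (A (br q z t)) (br u z t))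
      - - (\<Sum>z\<in>B. \<Sum>t\<in>B. b (br q (A z) t) (br u z t))
      - - (\<Sum>z\<in>B. \<Sum>t\<in>B. b (br q z (A t)) (br u z t)) = - K (A q) u"
      unfolding K_def fi by (simp add: form_simps sum.distrib)
    also have "\<dots> = 0" using orth br_perp_v unfolding A_def by simp
    finally show ?thesis by (simp add: q_def A_def)
  qed
  show thesis
  proof (rule that[of u])
    show "b u u = 0" "b u v = 1" using c by (simp_all add: u_def)
    fix x y z t s assume *: "b z v = 0" "b t v = 0" "b s v = 0"
    define q where "q = br u x y"
    have "K q q = 0" unfolding q_def using null[of x y] br_rotate[of u x y] by simp
    then have base: "b (br q i j) s = 0" if "i \<in> B" "j \<in> B" for i j using K_null that *(3) by blast
    have "b (br q i t) s = 0" if "i \<in> B" for i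
    proof -
      have "b (br q i t) s = (\<Sum>j\<in>B. b t j * b (br q i j) s)"
        by (rule eval[OF _ _ *(2)]) (auto intro!: linearI simp: br_simps form_simps br_v)
      then show ?thesis using base that by simp
    qed
    moreover have "b (br q z t) s = (\<Sum>i\<in>B. b z i * b (br q i t) s)"
      by (rule eval[OF _ _ *(1)]) (auto intro!: linearI simp: br_simps form_simps br_v)
    ultimately show "b (br (br u x y) z t) s = 0" by (simp add: q_def)
  qed
qed

lemma indecomposable_brackets:
  assumes indec: "indecomposable br b"
  obtains u where "b u u = 0" "b u v = 1"
    "\<And>x y z. x \<in> perp {u, v} \<Longrightarrow> y \<in> perp {u, v} \<Longrightarrow> z \<in> perp {u, v} \<Longrightarrow>
      br x y z = - b (br u x y) z *\<^sub>R v"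
proof -
  obtain u where u: "b u u = 0" "b u v = 1"
    and adapted: "\<And>x y z t s. b z v = 0 \<Longrightarrow> b t v = 0 \<Longrightarrow> b s v = 0 \<Longrightarrow> b (br (br u x y) z t) s = 0"
    using adapted_null_vector by metis
  define W where "W = perp {u, v}"
  have W_iff: "y \<in> W \<longleftrightarrow> b y u = 0 \<and> b y v = 0" for y by (simp add: W_def perp_def)
  have W: "subspace W" unfolding W_def by (rule subspace_perp)
  have W_pos: "b y y > 0" if "y \<in> W" "y \<noteq> 0" for y
    using spacelike_complement[OF u(2)] that W_iff by blast
  have v_u: "b v u = 1" using u(2) form_sym by metis
  note split = null_pair_decomposition[OF u, folded W_def]
  have eq_0: "x = 0" if "b x u = 0" "b x v = 0" "\<And>s. s \<in> W \<Longrightarrow> b x s = 0" for x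
  proof (rule form_eq_0I)
    fix y
    obtain s where "s \<in> W" "y = s + b y v *\<^sub>R u + b y u *\<^sub>R v" using split by blast
    then have "b x y = b x (s + b y v *\<^sub>R u + b y u *\<^sub>R v)" by simp
    then show "b x y = 0" using that \<open>s \<in> W\<close> by (simp add: form_simps)
  qed
  note br_u_W = br_in_perp[of u, folded W_def]
  have br_u: "b (br x y z) u = - b (br u x y) z" for x y z
    using form_invariant[of x y z u] form_sym[of z] br_rotate[of u x y] by simp
  \<comment> \<open>Pairing only with \<open>W\<close> ignores the component of a bracket along
    \<open>v\<close>, so \<open>Z\<close> is the centre of \<open>W\<close> under the projected
    bracket.\<close>
  define Z where "Z = {x\<in>W. \<forall>z t s. z \<in> W \<longrightarrow> t \<in> W \<longrightarrow> s \<in> W \<longrightarrow> b (br x z t) s = 0}"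
  have Z: "subspace Z" using W unfolding Z_def subspace_def by (simp add: br_simps form_simps)
  have br_u_Z: "br u x y \<in> Z" for x y using br_u_W adapted W_iff by (simp add: Z_def)
  define D where "D = perp ({u, v} \<union> Z)"
  have D_iff: "y \<in> D \<longleftrightarrow> y \<in> W \<and> (\<forall>z\<in>Z. b y z = 0)" for y
    by (auto simp: D_def W_iff perp_def)
  \<comment> \<open>Invariance moves the pairing onto \<open>d\<close> and [u,y,s]; the latter is in
    \<open>Z\<close>, which is orthogonal to \<open>D\<close>.\<close>
  have br_u_D: "br u d y = 0" if d: "d \<in> D" for d y
  proof (rule form_eq_0I)
    fix s
    have "b (br u d y) s = b d (br u y s)"
      using form_invariant[of u y d s] br_swap23[of u d y] by (simp add: form_simps)
    then show "b (br u d y) s = 0" using d br_u_Z D_iff by simp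
  qed
  have br_Z_D: "br d z y = 0" if d: "d \<in> D" and z: "z \<in> Z" for d z y
  proof -
    have dW: "d \<in> W" using d D_iff by blast
    have W_case: "br d z t = 0" if t: "t \<in> W" for t
    proof (rule eq_0)
      show "b (br d z t) u = 0" by (simp add: br_u br_u_D[OF d] form_simps)
      show "b (br d z t) v = 0" by (rule br_perp_v)
      fix s assume "s \<in> W"
      then have "b (br z d t) s = 0" using z dW t by (simp add: Z_def)
      then show "b (br d z t) s = 0" using br_swap12[of d z t] by (simp add: form_simps)
    qed
    obtain s where s: "s \<in> W" "y = s + b y v *\<^sub>R u + b y u *\<^sub>R v" using split by blast
    have "br d z u = 0" using br_u_D[OF d, of z] br_rotate[of u d z] by simp
    then have "br d z (s + b y v *\<^sub>R u + b y u *\<^sub>R v) = 0"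
      using W_case[OF s(1)] by (simp add: br_simps br_v)
    then show ?thesis using s(2) by simp
  qed
  have "is_ideal D"
    unfolding is_ideal_def
  proof (intro conjI ballI allI)
    show "subspace D" unfolding D_def by (rule subspace_perp)
    fix d x y assume d: "d \<in> D"
    have "b (br d x y) z = 0" if "z \<in> Z" for z
    proof -
      have "b (br d x y) z = b y (br d z x)"
        using form_invariant[of d x y z] br_swap23[of d x z] by (simp add: form_simps)
      then show ?thesis using br_Z_D[OF d that] by (simp add: form_simps)
    qed
    then show "br d x y \<in> D"
      using br_u[of d x y] br_u_D[OF d] br_perp_v by (simp add: D_iff W_iff form_simps)
  qed
  \<comment> \<open>\<open>D\<close> is contained in the positive-definite space \<open>W\<close>,
    so it meets its complement trivially.\<close>
  moreover have "D \<inter> perp D = {0}"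
  proof -
    have "y = 0" if "y \<in> D" "y \<in> perp D" for y
      using W_pos[of y] that D_iff by (force simp: perp_def)
    then show ?thesis using subspace_0[OF subspace_perp] unfolding D_def by blast
  qed
  ultimately have "D = {0} \<or> D = UNIV" using nondegenerate_ideal_trivial[OF indec] by blast
  moreover have "u \<notin> D" using u(2) by (simp add: D_iff W_iff)
  ultimately have D0: "D = {0}" by blast
  have "Z \<inter> perp Z = {0}"
  proof -
    have "y = 0" if "y \<in> Z" "y \<in> perp Z" for y
      using W_pos[of y] that by (force simp: perp_def Z_def)
    then show ?thesis using subspace_0[OF subspace_perp] subspace_0[OF Z] by blast
  qed
  have WZ: "x \<in> Z" if x: "x \<in> W" for x
  proof -
    obtain y where y: "y \<in> Z" "x - y \<in> perp Z"
      using perp_decomposition[OF Z \<open>Z \<inter> perp Z = {0}\<close>] by metis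
    then have "x - y \<in> D" using x W by (auto simp: D_iff Z_def perp_def subspace_diff)
    then show ?thesis using D0 y(1) by simp
  qed
  show thesis
  proof (rule that[OF u])
    fix x y z assume "x \<in> perp {u, v}" "y \<in> perp {u, v}" "z \<in> perp {u, v}"
    then have xyz: "x \<in> W" "y \<in> W" "z \<in> W" by (simp_all add: W_def)
    \<comment> \<open>Pairing with \<open>u\<close> determines the coefficient of \<open>v\<close>.
      The component in \<open>W\<close> is zero because \<open>W\<close> is contained in
      \<open>Z\<close>.\<close>
    have "br x y z + b (br u x y) z *\<^sub>R v = 0"
    proof (rule eq_0)
      show "b (br x y z + b (br u x y) z *\<^sub>R v) u = 0" by (simp add: form_simps br_u v_u)
      show "b (br x y z + b (br u x y) z *\<^sub>R v) v = 0" by (simp add: form_simps br_perp_v v_null)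
      fix s assume s: "s \<in> W"
      then have "b v s = 0" using W_iff form_sym by metis
      moreover have "b (br x y z) s = 0" using WZ[OF xyz(1)] xyz s by (simp add: Z_def)
      ultimately show "b (br x y z + b (br u x y) z *\<^sub>R v) s = 0" by (simp add: form_simps)
    qed
    then show "br x y z = - b (br u x y) z *\<^sub>R v" by (simp add: eq_neg_iff_add_eq_0)
  qed
qed

lemma compact_semisimple_complement:
  assumes indec: "indecomposable br b" and u: "b u u = 0" "b u v = 1"
    and brackets: "\<And>x y z. x \<in> perp {u, v} \<Longrightarrow> y \<in> perp {u, v} \<Longrightarrow> z \<in> perp {u, v} \<Longrightarrow>
      br x y z = - b (br u x y) z *\<^sub>R v"
  shows "compact_semisimple_on (perp {u, v}) (br u)"
proof -
  define W where "W = perp {u, v}"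
  have W_iff: "y \<in> W \<longleftrightarrow> b y u = 0 \<and> b y v = 0" for y by (simp add: W_def perp_def)
  have W: "subspace W" unfolding W_def by (rule subspace_perp)
  have W_pos: "b y y > 0" if "y \<in> W" "y \<noteq> 0" for y
    using spacelike_complement[OF u(2)] that W_iff by blast
  note br_u_W = br_in_perp[of u, folded W_def]
  \<comment> \<open>The fundamental identity with \<open>u\<close> in both the outer and the inner
    bracket; the term with [u,x,u] drops out.\<close>
  have jacobi: "br u x (br u y z) + br u y (br u z x) + br u z (br u x y) = 0" for x y z
    using br_fundamental[of u x u y z] br_swap23[of u z x] br_swap23[of u z "br u x y"]
    by (simp add: br_simps br_same)
  have lie: "lie_algebra_on W (br u)"
    unfolding lie_algebra_on_def using W br_u_W jacobi by (simp add: br_simps br_same)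
  have "(\<forall>x\<in>W. \<forall>y\<in>W. \<forall>z\<in>W. \<forall>c::real. b (c *\<^sub>R x + y) z = c * b x z + b y z)
    \<and> (\<forall>x\<in>W. \<forall>y\<in>W. b x y = b y x) \<and> (\<forall>x\<in>W. x \<noteq> 0 \<longrightarrow> b x x > 0)
    \<and> (\<forall>x\<in>W. \<forall>y\<in>W. \<forall>z\<in>W. b (br u x y) z = - b y (br u x z))"
    using W_pos by (intro conjI ballI allI impI form_sym form_invariant) (simp_all add: form_simps)
  then have compact: "compact_lie_on W (br u)" unfolding compact_lie_on_def using lie by blast
  have "semisimple_on W (br u)"
  proof (rule compact_centerless_semisimple[OF compact])
    fix x assume x: "x \<in> W" and zero: "\<And>y. y \<in> W \<Longrightarrow> br u x y = 0"
    note split = null_pair_decomposition[OF u, folded W_def]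
    have u_x: "br u x y = 0" for y
    proof -
      obtain s where s: "s \<in> W" "y = s + b y v *\<^sub>R u + b y u *\<^sub>R v" using split by blast
      have "br u x (s + b y v *\<^sub>R u + b y u *\<^sub>R v) = 0"
        using zero[OF s(1)] by (simp add: br_simps br_v br_same)
      then show ?thesis using s(2) by simp
    qed
    \<comment> \<open>Once [u,x,-] vanishes, \<open>brackets\<close> gives [x,s,t] = 0 for s, t in
      \<open>W\<close>; the remaining components involve \<open>u\<close> or
      \<open>v\<close>.\<close>
    have central: "br x y z = 0" for y z
    proof -
      obtain s where s: "s \<in> W" "y = s + b y v *\<^sub>R u + b y u *\<^sub>R v" using split by blast
      obtain t where t: "t \<in> W" "z = t + b z v *\<^sub>R u + b z u *\<^sub>R v" using split by blast
      have "br x s t = 0"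
        using brackets[of x s t] x s(1) t(1) u_x by (simp add: W_def form_simps)
      moreover have "br x u r = 0" "br x r u = 0" for r
        using u_x[of r] br_swap12[of x u r] br_rotate[of u x r] by simp_all
      ultimately have "br x (s + b y v *\<^sub>R u + b y u *\<^sub>R v) (t + b z v *\<^sub>R u + b z u *\<^sub>R v) = 0"
        by (simp add: br_simps br_v)
      then show ?thesis using s(2) t(2) by simp
    qed
    show "x = 0"
    proof (rule ccontr)
      assume "x \<noteq> 0"
      then have "b x x \<noteq> 0" using W_pos[OF x] by simp
      then show False
        using no_nonnull_central_vector[OF indec central _ v_null v_nonzero] by blast
    qed
  qed
  then show ?thesis using compact by (simp add: compact_semisimple_on_def W_def)
qed

end

section \<open>Lorentzian signature and the structure theorem\<close>

text \<open>Take the timelike basis vector \<open>e 0\<close>. A vector orthogonal to it has zero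
  coordinate there, so its square is the sum of the squares of the other coordinates.\<close>

lemma lorentzian_timelike:
  fixes b :: "'a::euclidean_space \<Rightarrow> 'a \<Rightarrow> real"
  assumes b: "sym_bilinear b" and "lorentzian b"
  obtains e where "\<And>x. b x e = 0 \<Longrightarrow> x \<noteq> 0 \<Longrightarrow> b x x > 0"
proof -
  obtain e :: "nat \<Rightarrow> 'a" where "span (e ` {..<DIM('a)}) = UNIV
      \<and> (\<forall>i<DIM('a). \<forall>j<DIM('a). i \<noteq> j \<longrightarrow> b (e i) (e j) = 0)
      \<and> b (e 0) (e 0) = -1
      \<and> (\<forall>i. 0 < i \<and> i < DIM('a) \<longrightarrow> b (e i) (e i) = 1)"
    using assms(2) unfolding lorentzian_def by (rule exE)
  then have e: "span (e ` {..<DIM('a)}) = UNIV"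
      "\<And>i j. i < DIM('a) \<Longrightarrow> j < DIM('a) \<Longrightarrow> i \<noteq> j \<Longrightarrow> b (e i) (e j) = 0"
      "b (e 0) (e 0) = -1" "\<And>i. 0 < i \<Longrightarrow> i < DIM('a) \<Longrightarrow> b (e i) (e i) = 1"
    by blast+
  have lin1: "linear (\<lambda>x. b x y)" for y using b by (simp add: sym_bilinear_def)
  have sym: "b x y = b y x" for x y using b unfolding sym_bilinear_def by blast
  have lin2: "linear (\<lambda>x. b y x)" for y using lin1[of y] by (simp add: sym[of y])
  have "b x x > 0" if x: "b x (e 0) = 0" "x \<noteq> 0" for x
  proof -
    define n where "n = DIM('a)"
    have "x \<in> span (e ` {..<n})" using e(1) by (simp add: n_def)
    then have "\<exists>c. x = (\<Sum>i<n. c i *\<^sub>R e i)"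
    proof (induction rule: span_induct_alt)
      case base
      show ?case by (rule exI[of _ "\<lambda>_. 0"]) simp
    next
      case (step a g h)
      then obtain j c where "j < n" "g = e j" "h = (\<Sum>i<n. c i *\<^sub>R e i)" by blast
      then show ?case
        by (intro exI[of _ "\<lambda>i. (if i = j then a else 0) + c i"])
          (simp add: scaleR_left_distrib sum.distrib if_distrib[of "\<lambda>r. r *\<^sub>R _"] cong: if_cong)
    qed
    then obtain c where c: "x = (\<Sum>i<n. c i *\<^sub>R e i)" by blast
    have coeff: "b x (e j) = c j * b (e j) (e j)" if "j < n" for j
    proof -
      have "b x (e j) = (\<Sum>i<n. c i * b (e i) (e j))"
        unfolding c by (simp add: linear_sum[OF lin1] linear_scale[OF lin1])
      also have "\<dots> = (\<Sum>i<n. if i = j then c j * b (e j) (e j) else 0)"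
        using e(2) that by (intro sum.cong) (auto simp: n_def)
      finally show ?thesis using that by simp
    qed
    have c0: "c 0 = 0" using coeff[of 0] x(1) e(3) by (simp add: n_def)
    have "b x x = (\<Sum>i<n. c i * b x (e i))"
      by (subst (2) c) (simp add: linear_sum[OF lin2] linear_scale[OF lin2])
    also have "\<dots> = (\<Sum>i<n. (c i)\<^sup>2)"
    proof (intro sum.cong refl)
      fix i assume i: "i \<in> {..<n}"
      show "c i * b x (e i) = (c i)\<^sup>2"
        using i c0 e(4)[of i] coeff[of i] by (cases "i = 0") (auto simp: n_def power2_eq_square)
    qed
    finally have sq: "b x x = (\<Sum>i<n. (c i)\<^sup>2)" .
    have "b x x \<noteq> 0"
    proof
      assume "b x x = 0"
      then have "\<forall>i<n. c i = 0" using sq by (simp add: sum_nonneg_eq_0_iff)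
      then show False using c x(2) by simp
    qed
    moreover have "b x x \<ge> 0" unfolding sq by (intro sum_nonneg) simp
    ultimately show ?thesis by simp
  qed
  then show thesis using that by blast
qed

theorem mainTheorem4:
  fixes br :: "'a::euclidean_space \<Rightarrow> 'a \<Rightarrow> 'a \<Rightarrow> 'a"
    and b :: "'a \<Rightarrow> 'a \<Rightarrow> real"
  assumes "metric_3lie br b"
    and "lorentzian b"
    and "indecomposable br b"
  shows "DIM('a) = 1 \<or> simple_3lie br \<or>
    (\<exists>(u::'a) v (x::nat \<Rightarrow> 'a) n (f::nat \<Rightarrow> nat \<Rightarrow> nat \<Rightarrow> real) (L::'a \<Rightarrow> 'a \<Rightarrow> 'a).
        witt_basis b u v x n
      \<and> (\<forall>a<n. \<forall>c<n. L (x a) (x c) = (\<Sum>d<n. f a c d *\<^sub>R x d))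
      \<and> compact_semisimple_on (span (x ` {..<n})) L
      \<and> (\<forall>a<n. \<forall>c<n. br u (x a) (x c) = (\<Sum>d<n. f a c d *\<^sub>R x d))
      \<and> (\<forall>a<n. \<forall>c<n. \<forall>d<n. br (x a) (x c) (x d) = - (b (L (x a) (x c)) (x d)) *\<^sub>R v)
      \<and> (\<forall>y z. br v y z = 0)
      \<and> (\<forall>z. br u v z = 0))"
proof (cases "DIM('a) = 1 \<or> simple_3lie br")
  case False
  interpret metric_three_lie br b by unfold_locales (rule assms(1))
  obtain e where e: "\<And>x. b x e = 0 \<Longrightarrow> x \<noteq> 0 \<Longrightarrow> b x x > 0"
    using lorentzian_timelike[OF form_sym_bilinear assms(2)] by blast
  obtain I where I: "is_ideal I" "I \<noteq> {0}" "I \<noteq> UNIV"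
    using False unfolding simple_3lie_def is_ideal_def by blast
  have "I \<inter> perp I \<noteq> {0}" using nondegenerate_ideal_trivial[OF assms(3) I(1)] I by blast
  moreover have "0 \<in> I \<inter> perp I"
    using I(1) subspace_0 subspace_perp unfolding is_ideal_def by blast
  ultimately obtain v where v: "v \<in> I" "v \<in> perp I" "v \<noteq> 0" by blast
  interpret null_vector br b e v
    by unfold_locales (use e v in \<open>auto simp: perp_def\<close>)
  \<comment> \<open>The bracket lies in both \<open>I\<close> and \<open>perp I\<close>, so it is
    null and orthogonal to \<open>v\<close>, hence a multiple of \<open>v\<close>.\<close>
  have "\<exists>c. br v x y = c *\<^sub>R v" for x y
  proof (rule v_perp_null)
    have J: "br v x y \<in> I" "br v x y \<in> perp I"
      using v I(1) ideal_perp[OF I(1)] by (simp_all add: is_ideal_def)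
    then show "b (br v x y) v = 0" "b (br v x y) (br v x y) = 0" using v by (simp_all add: perp_def)
  qed
  then interpret central_null_vector br b e v
    by unfold_locales (rule null_ideal_central)
  obtain u where u: "b u u = 0" "b u v = 1"
    and brackets: "\<And>x y z. x \<in> perp {u, v} \<Longrightarrow> y \<in> perp {u, v} \<Longrightarrow> z \<in> perp {u, v} \<Longrightarrow>
      br x y z = - b (br u x y) z *\<^sub>R v"
    using indecomposable_brackets[OF assms(3)] by metis
  define W where "W = perp {u, v}"
  have W_iff: "y \<in> W \<longleftrightarrow> b y u = 0 \<and> b y v = 0" for y by (simp add: W_def perp_def)
  have W: "subspace W" unfolding W_def by (rule subspace_perp)
  have W_pos: "b y y > 0" if "y \<in> W" "y \<noteq> 0" for y
    using spacelike_complement[OF u(2)] that W_iff by blast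
  obtain B where B: "finite B" "span B = W" "independent B"
    using b_orthonormal_basis_exists[OF form_sym_bilinear W W_pos] by metis
  obtain x where x: "bij_betw x {..<card B} B"
    using ex_bij_betw_nat_finite[OF B(1)] by (auto simp: atLeast0LessThan)
  define n where "n = card B"
  have xB: "x ` {..<n} = B" and inj: "inj_on x {..<n}" using x by (auto simp: bij_betw_def n_def)
  have xW: "x a \<in> W" if "a < n" for a using that xB B(2) span_base[of "x a" B] by auto
  note br_u_W = br_in_perp[of u, folded W_def]
  have "\<exists>c. y = (\<Sum>d<n. c d *\<^sub>R x d)" if "y \<in> W" for y
  proof -
    have "y \<in> range (\<lambda>c. \<Sum>i\<in>B. c i *\<^sub>R i)" using that B(2) span_finite[OF B(1)] by metis
    then obtain c where "y = (\<Sum>i\<in>B. c i *\<^sub>R i)" by (rule rangeE)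
    also have "\<dots> = (\<Sum>d<n. c (x d) *\<^sub>R x d)"
      using sum.reindex[OF inj, of "\<lambda>i. c i *\<^sub>R i"] by (simp add: xB)
    finally show ?thesis by (rule exI[of _ "\<lambda>d. c (x d)"])
  qed
  \<comment> \<open>Every value of [u,-,-] is in \<open>W\<close>, so structure constants can be
    chosen for all indices at once, without the bound \<open>n\<close>.\<close>
  then have "\<forall>a c. \<exists>g. br u (x a) (x c) = (\<Sum>d<n. g d *\<^sub>R x d)"
    using br_u_W by blast
  then obtain f where f: "\<And>a c. br u (x a) (x c) = (\<Sum>d<n. f a c d *\<^sub>R x d)" by metis
  have perp_span: "{y. \<forall>w\<in>span {u, v}. b w y = 0} = W"
  proof (intro set_eqI iffI)
    fix y assume "y \<in> {y. \<forall>w\<in>span {u, v}. b w y = 0}"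
    then show "y \<in> W" using form_sym[of y] by (simp add: W_iff span_base)
  next
    fix y assume y: "y \<in> W"
    have "b w y = 0" if "w \<in> span {u, v}" for w
      using that y form_sym[of y]
      by (induction rule: span_induct_alt) (auto simp: W_iff form_simps)
    then show "y \<in> {y. \<forall>w\<in>span {u, v}. b w y = 0}" by blast
  qed
  have "witt_basis b u v x n"
    unfolding witt_basis_def xB perp_span using u v_null inj B W_pos by blast
  moreover have "compact_semisimple_on (span (x ` {..<n})) (br u)"
    using compact_semisimple_complement[OF assms(3) u brackets] by (simp add: xB B(2) W_def)
  moreover have "br (x a) (x c) (x d) = - (b (br u (x a) (x c)) (x d)) *\<^sub>R v"
    if "a < n" "c < n" "d < n" for a c d
    using brackets xW that unfolding W_def by blast
  ultimately show ?thesis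
    by (intro disjI2 exI[of _ u] exI[of _ v] exI[of _ x] exI[of _ n] exI[of _ f] exI[of _ "br u"])
      (simp add: f br_v)
qed blast

end
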